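(* Let $\mathbf{k}$ be a field of positive characteristic and let $A=\mathbf{k}\langle x_1,\dots,x_s\rangle$ be the free associative algebra over $\mathbf{k}$ on $x_1,\dots,x_s$. Then $A$ has no commutative $\mathbf{k}$-subalgebra of transcendence degree $\geq 2$ over $\mathbf{k}$.
   Context: Algebras and subalgebras are unital and associative. The transcendence degree of a commutative $\mathbf{k}$-subalgebra $C$ is the supremum of the cardinalities of subsets of $C$ that are algebraically independent over $\mathbf{k}$. *)

theory Defs
  imports
    "HOL-Library.Poly_Mapping"
    "HOL-Library.Extended_Nat"
    "HOL-Computational_Algebra.Computational_Algebra"
begin

text \<open>
  Words over the alphabet \<open>'x\<close>, i.e. the free monoid on \<open>'x\<close>.  The monoid is written additively
  because the product of the type \<open>'m \<Rightarrow>\<^sub>0 'k\<close> is convolution along an additive monoid \<open>'m\<close>; so the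
  type \<open>'x word \<Rightarrow>\<^sub>0 'k\<close> is the monoid algebra of the free monoid, that is, the free associative
  algebra on \<open>'x\<close>.
\<close>

datatype 'x word = Word (letters: "'x list")

instantiation word :: (type) monoid_add
begin

definition zero_word :: "'a word" where
  "0 = Word []"

definition plus_word :: "'a word \<Rightarrow> 'a word \<Rightarrow> 'a word" where
  "u + v = Word (letters u @ letters v)"

instance
  by standard (simp_all add: zero_word_def plus_word_def)

end

lemma letters_zero [simp]: "letters 0 = []"
  by (simp add: zero_word_def)

lemma letters_plus [simp]: "letters (u + v) = letters u @ letters v"
  by (simp add: plus_word_def)

text \<open>The free associative algebra \<open>k\<langle>x\<^sub>1, \<dots>, x\<^sub>s\<rangle>\<close>, with the letter \<open>i\<close> standing for \<open>x\<^sub>i\<close>.\<close>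

definition free_algebra :: "nat \<Rightarrow> (nat word \<Rightarrow>\<^sub>0 'k::field) set" where
  "free_algebra s = {a. \<forall>w \<in> Poly_Mapping.keys a. set (letters w) \<subseteq> {1..s}}"

definition smult_alg :: "'k::field \<Rightarrow> ('m \<Rightarrow>\<^sub>0 'k) \<Rightarrow> ('m \<Rightarrow>\<^sub>0 'k)" where
  "smult_alg c a = Poly_Mapping.map ((*) c) a"

definition is_subalgebra :: "('m::monoid_add \<Rightarrow>\<^sub>0 'k::field) set \<Rightarrow> bool" where
  "is_subalgebra C \<longleftrightarrow>
     1 \<in> C \<and>
     (\<forall>a\<in>C. \<forall>b\<in>C. a + b \<in> C) \<and>
     (\<forall>a\<in>C. \<forall>b\<in>C. a * b \<in> C) \<and>
     (\<forall>c. \<forall>a\<in>C. smult_alg c a \<in> C)"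

definition is_commutative :: "'a::times set \<Rightarrow> bool" where
  "is_commutative C \<longleftrightarrow> (\<forall>a\<in>C. \<forall>b\<in>C. a * b = b * a)"

text \<open>
  Commutative polynomials in the variables \<open>X\<^sub>0, X\<^sub>1, \<dots>\<close> over \<open>k\<close> have the type
  \<open>(nat \<Rightarrow>\<^sub>0 nat) \<Rightarrow>\<^sub>0 'k\<close>; the exponent of \<open>X\<^sub>i\<close> in the monomial \<open>m\<close> is \<open>lookup m i\<close>.  They are evaluated
  at a list of elements of an algebra.  The product is taken in the order of the variables, which
  is irrelevant when the elements of the list commute.
\<close>

definition eval_monom :: "'a::monoid_mult list \<Rightarrow> (nat \<Rightarrow>\<^sub>0 nat) \<Rightarrow> 'a" where
  "eval_monom as m = prod_list (map (\<lambda>i. as ! i ^ Poly_Mapping.lookup m i) [0..<length as])"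

definition eval_poly ::
  "('m::monoid_add \<Rightarrow>\<^sub>0 'k::field) list \<Rightarrow> ((nat \<Rightarrow>\<^sub>0 nat) \<Rightarrow>\<^sub>0 'k) \<Rightarrow> ('m \<Rightarrow>\<^sub>0 'k)" where
  "eval_poly as p =
     (\<Sum>m\<in>Poly_Mapping.keys p. smult_alg (Poly_Mapping.lookup p m) (eval_monom as m))"

text \<open>
  No finitely many distinct elements of \<open>S\<close> satisfy a nontrivial polynomial relation over \<open>k\<close>.
  The notion is meaningful for \<open>S\<close> contained in a commutative subalgebra.
\<close>

definition algebraically_independent :: "('m::monoid_add \<Rightarrow>\<^sub>0 'k::field) set \<Rightarrow> bool" where
  "algebraically_independent S \<longleftrightarrow>
     (\<forall>as p. distinct as \<and> set as \<subseteq> S \<and>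
        (\<forall>m\<in>Poly_Mapping.keys p. Poly_Mapping.keys m \<subseteq> {..<length as}) \<and>
        eval_poly as p = 0 \<longrightarrow> p = 0)"

text \<open>All infinite cardinalities are identified with \<open>\<infinity>\<close>.\<close>

definition ecard :: "'a set \<Rightarrow> enat" where
  "ecard S = (if finite S then enat (card S) else \<infinity>)"

definition trdeg :: "('m::monoid_add \<Rightarrow>\<^sub>0 'k::field) set \<Rightarrow> enat" where
  "trdeg C = (SUP S \<in> {S. S \<subseteq> C \<and> algebraically_independent S}. ecard S)"

lemma lookup_smult_alg: "Poly_Mapping.lookup (smult_alg c a) w = c * Poly_Mapping.lookup a w"
  by (simp add: smult_alg_def Poly_Mapping.map.rep_eq when_def)

lemma is_subalgebra_free_algebra: "is_subalgebra (free_algebra s :: (nat word \<Rightarrow>\<^sub>0 'k::field) set)"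
  unfolding is_subalgebra_def
proof (intro conjI ballI allI)
  show "1 \<in> (free_algebra s :: (nat word \<Rightarrow>\<^sub>0 'k) set)"
    by (simp add: free_algebra_def)
next
  fix a b :: "nat word \<Rightarrow>\<^sub>0 'k"
  assume "a \<in> free_algebra s" "b \<in> free_algebra s"
  then show "a + b \<in> free_algebra s"
    using Poly_Mapping.keys_add[of a b] by (auto simp: free_algebra_def)
next
  fix a b :: "nat word \<Rightarrow>\<^sub>0 'k"
  assume "a \<in> free_algebra s" "b \<in> free_algebra s"
  then show "a * b \<in> free_algebra s"
    using Poly_Mapping.keys_mult[of a b] by (fastforce simp: free_algebra_def)
next
  fix c and a :: "nat word \<Rightarrow>\<^sub>0 'k"
  assume "a \<in> free_algebra s"
  then show "smult_alg c a \<in> free_algebra s"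
    by (auto simp: free_algebra_def in_keys_iff lookup_smult_alg)
qed

end

theory Submission
  imports Defs
begin

text \<open>
  It suffices to show that two commuting elements \<open>a\<close> and \<open>b\<close> of a free algebra are algebraically
  dependent.  This is a dimension count: among the elements of degree at most \<open>n\<close>, those that
  commute with a nonscalar \<open>a\<close> form a space of dimension at most \<open>n + 1\<close>, whereas the elements
  \<open>a\<^sup>i b\<^sup>j\<close> with \<open>i, j \<le> M\<close> number \<open>(M + 1)\<^sup>2\<close>, commute with \<open>a\<close>, and have degree at most \<open>M D\<close>, where
  \<open>D = deg a + deg b\<close>.  For \<open>M = D\<close> there are too many of them to be linearly independent, and a
  linear relation between them is a polynomial relation between \<open>a\<close> and \<open>b\<close>.

  The bound on the dimension comes from the absence of cancellation in top degree
  (\<open>lookup_mult_top\<close>): the coefficient of a product at a word of maximal length is a product of two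
  coefficients, the word being cut in the only place that the degrees permit.  Let \<open>W\<close> be a longest
  word of \<open>a\<close> and \<open>x\<close> an element of degree at most \<open>n\<close> that commutes with \<open>a\<close>.  Write
  \<open>W\<^sup>n = p q\<close> with \<open>p\<close> of length \<open>n\<close>.  For every word \<open>r\<close> of length \<open>n\<close>, the coefficients at \<open>p q r\<close> in
  \<open>a\<^sup>n x = x a\<^sup>n\<close> give \<open>a\<^sup>n(p q) x(r) = x(p) a\<^sup>n(q r)\<close>, and \<open>a\<^sup>n(p q) = a(W)\<^sup>n \<noteq> 0\<close>.  So if \<open>x\<close> vanishes at
  \<open>p\<close>, then it has degree less than \<open>n\<close>.  Descending in \<open>n\<close>, the element \<open>x\<close> is determined by its
  coefficients at the \<open>n + 1\<close> prefixes of length at most \<open>n\<close> of the infinite word \<open>W W W \<dots>\<close>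
  (\<open>centralizer_separated\<close>).
\<close>

section \<open>Degrees in the free algebra\<close>

definition degree_le :: "nat \<Rightarrow> ('x word \<Rightarrow>\<^sub>0 'k::zero) \<Rightarrow> bool" where
  "degree_le n f \<longleftrightarrow> (\<forall>w\<in>Poly_Mapping.keys f. length (letters w) \<le> n)"

lemma degree_leD: "degree_le n f \<Longrightarrow> Poly_Mapping.lookup f w \<noteq> 0 \<Longrightarrow> length (letters w) \<le> n"
  by (simp add: degree_le_def in_keys_iff)

lemma degree_le_mono: "degree_le m f \<Longrightarrow> m \<le> n \<Longrightarrow> degree_le n f"
  by (force simp: degree_le_def)

lemma degree_le_exists: "\<exists>n. degree_le n f"
proof -
  have "degree_le (Max ((\<lambda>w. length (letters w)) ` Poly_Mapping.keys f)) f"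
    unfolding degree_le_def by (auto intro!: Max_ge)
  then show ?thesis ..
qed

lemma degree_le_mult:
  fixes f g :: "'x word \<Rightarrow>\<^sub>0 'k::semiring_0"
  assumes "degree_le m f" "degree_le n g"
  shows "degree_le (m + n) (f * g)"
  using assms Poly_Mapping.keys_mult[of f g] unfolding degree_le_def
  by (fastforce intro: add_mono)

lemma degree_le_power:
  fixes f :: "'x word \<Rightarrow>\<^sub>0 'k::ring_1"
  assumes "degree_le m f"
  shows "degree_le (i * m) (f ^ i)"
proof (induction i)
  case 0
  then show ?case by (simp add: degree_le_def)
next
  case (Suc i)
  then show ?case using degree_le_mult[OF assms Suc.IH] by simp
qed

lemma degree_le_smult_alg: "degree_le n f \<Longrightarrow> degree_le n (smult_alg c f)"
  by (auto simp: degree_le_def in_keys_iff lookup_smult_alg)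

lemma degree_le_sum:
  assumes "\<And>i. i \<in> I \<Longrightarrow> degree_le n (f i)"
  shows "degree_le n (\<Sum>i\<in>I. f i)"
  using assms keys_sum[of f I] unfolding degree_le_def by blast

text \<open>A word of length \<open>m + n\<close> has only one factorization into words of length at most \<open>m\<close> and \<open>n\<close>, so
  the convolution reduces to one term.\<close>

lemma lookup_mult_top:
  fixes f g :: "'x word \<Rightarrow>\<^sub>0 'k::semiring_0"
  assumes f: "degree_le (length u) f" and g: "degree_le (length v) g"
  shows "Poly_Mapping.lookup (f * g) (Word (u @ v)) =
           Poly_Mapping.lookup f (Word u) * Poly_Mapping.lookup g (Word v)"
proof -
  have split: "l = Word u \<and> q = Word v"
    if "Poly_Mapping.lookup f l \<noteq> 0" "Poly_Mapping.lookup g q \<noteq> 0" "Word (u @ v) = l + q" for l q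
  proof -
    have eq: "u @ v = letters l @ letters q"
      using that(3) by (simp add: plus_word_def)
    have "length (letters l) \<le> length u" "length (letters q) \<le> length v"
      using degree_leD[OF f that(1)] degree_leD[OF g that(2)] by auto
    moreover have "length u + length v = length (letters l) + length (letters q)"
      using arg_cong[OF eq, of length] by simp
    ultimately have "length u = length (letters l)" by linarith
    with eq have "u = letters l" "v = letters q" by auto
    then show ?thesis by simp
  qed
  have inner: "Poly_Mapping.lookup f l * (\<Sum>q. Poly_Mapping.lookup g q when Word (u @ v) = l + q) =
      (Poly_Mapping.lookup f (Word u) * Poly_Mapping.lookup g (Word v) when l = Word u)" for l
  proof (cases "Poly_Mapping.lookup f l = 0")
    case True
    then show ?thesis by (auto simp: when_def)
  next
    case False
    have "(\<Sum>q. Poly_Mapping.lookup g q when Word (u @ v) = l + q) =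
        (\<Sum>q. (Poly_Mapping.lookup g q when l = Word u) when q = Word v)"
      using split[OF False] by (intro Sum_any.cong) (fastforce simp: when_def plus_word_def)
    also have "\<dots> = (Poly_Mapping.lookup g (Word v) when l = Word u)"
      by (rule Sum_any_when_equal)
    finally show ?thesis by (auto simp: when_def)
  qed
  show ?thesis
    by (simp add: lookup_mult inner)
qed

lemma lookup_power_top:
  fixes f :: "'x word \<Rightarrow>\<^sub>0 'k::ring_1"
  assumes "degree_le (length u) f"
  shows "Poly_Mapping.lookup (f ^ n) (Word (concat (replicate n u))) =
           Poly_Mapping.lookup f (Word u) ^ n"
proof (induction n)
  case 0
  then show ?case by (simp add: lookup_one zero_word_def)
next
  case (Suc n)
  have "degree_le (length (concat (replicate n u))) (f ^ n)"
    using degree_le_power[OF assms, of n] by (simp add: length_concat sum_list_replicate)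
  then show ?case
    using lookup_mult_top[OF assms] Suc.IH by simp
qed

section \<open>Centralizers grow linearly\<close>

definition periodic_prefix :: "'x list \<Rightarrow> nat \<Rightarrow> 'x word" where
  "periodic_prefix u n = Word (take n (concat (replicate n u)))"

lemma centralizer_degree_drop:
  fixes a x :: "'x word \<Rightarrow>\<^sub>0 'k::field"
  assumes a: "degree_le (length u) a" "Poly_Mapping.lookup a (Word u) \<noteq> 0" "u \<noteq> []"
    and comm: "a * x = x * a" and x: "degree_le n x"
    and vanish: "Poly_Mapping.lookup x (periodic_prefix u n) = 0"
    and r: "length (letters r) = n"
  shows "Poly_Mapping.lookup x r = 0"
proof -
  let ?A = "a ^ n" and ?w = "concat (replicate n u)"
  define p q where "p = take n ?w" and "q = drop n ?w"
  have pq: "?w = p @ q" by (simp add: p_def q_def)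
  have len_w: "length ?w = n * length u"
    by (simp add: length_concat sum_list_replicate)
  \<comment> \<open>The exponent \<open>n\<close> makes the power of \<open>u\<close> long enough to have a prefix of length \<open>n\<close>.\<close>
  have len_p: "length p = n"
    using len_w \<open>u \<noteq> []\<close> by (simp add: p_def Suc_le_eq)
  have deg_A: "degree_le (length ?w) ?A"
    using degree_le_power[OF a(1)] by (simp add: len_w)
  have A_w: "Poly_Mapping.lookup ?A (Word ?w) \<noteq> 0"
    using lookup_power_top[OF a(1), of n] a(2) by simp
  have "Poly_Mapping.lookup ?A (Word ?w) * Poly_Mapping.lookup x r =
      Poly_Mapping.lookup (?A * x) (Word (?w @ letters r))"
    using lookup_mult_top[OF deg_A, of "letters r" x] x r by simp
  also have "\<dots> = Poly_Mapping.lookup (x * ?A) (Word (p @ q @ letters r))"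
    using power_commuting_commutes[OF comm, of n] by (simp add: pq)
  also have "\<dots> = Poly_Mapping.lookup x (Word p) * Poly_Mapping.lookup ?A (Word (q @ letters r))"
    using lookup_mult_top[of p x "q @ letters r" ?A] x deg_A len_p r pq by (simp add: add.commute)
  also have "\<dots> = 0"
    using vanish by (simp add: periodic_prefix_def p_def)
  finally show ?thesis using A_w by simp
qed

lemma centralizer_separated:
  fixes a x :: "'x word \<Rightarrow>\<^sub>0 'k::field"
  assumes a: "degree_le (length u) a" "Poly_Mapping.lookup a (Word u) \<noteq> 0" "u \<noteq> []"
    and comm: "a * x = x * a" and "degree_le n x"
    and "\<And>m. m \<le> n \<Longrightarrow> Poly_Mapping.lookup x (periodic_prefix u m) = 0"
  shows "x = 0"
  using assms(5,6)
proof (induction n)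
  case 0
  have "Poly_Mapping.lookup x r = 0" for r
    using centralizer_degree_drop[OF a comm 0(1) 0(2)[of 0], of r] degree_leD[OF 0(1), of r]
    by fastforce
  then show ?case by (intro poly_mapping_eqI) simp
next
  case (Suc n)
  have "length (letters r) \<le> n" if "Poly_Mapping.lookup x r \<noteq> 0" for r
    using centralizer_degree_drop[OF a comm Suc.prems(1) Suc.prems(2)[of "Suc n"], of r]
      degree_leD[OF Suc.prems(1) that] that by fastforce
  then have "degree_le n x"
    by (simp add: degree_le_def in_keys_iff)
  then show ?case using Suc by simp
qed

section \<open>Linear and polynomial relations\<close>

text \<open>A homogeneous linear system with more unknowns than equations has a nontrivial solution.  One
  equation and one unknown are eliminated at a time.\<close>

lemma homogeneous_system_nontrivial_solution:
  fixes v :: "'i \<Rightarrow> 'j \<Rightarrow> 'k::field"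
  assumes "finite J" "finite I" "card J < card I"
  shows "\<exists>c. (\<exists>i\<in>I. c i \<noteq> 0) \<and> (\<forall>j\<in>J. (\<Sum>i\<in>I. c i * v i j) = 0)"
  using assms
proof (induction J arbitrary: I v rule: finite_induct)
  case empty
  then have "\<exists>i. i \<in> I" by (auto simp: card_gt_0_iff)
  then show ?case by (intro exI[of _ "\<lambda>_. 1"]) auto
next
  case (insert e J)
  show ?case
  proof (cases "\<forall>i\<in>I. v i e = 0")
    case True
    have "card J < card I" using insert by simp
    from insert.IH[OF insert.prems(1) this, of v] True show ?thesis by auto
  next
    case False
    then obtain k where k: "k \<in> I" "v k e \<noteq> 0" by blast
    let ?I = "I - {k}"
    define v' where "v' i j = v i j - v i e / v k e * v k j" for i j
    have "card J < card ?I" using insert k by simp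
    from insert.IH[OF _ this, of v'] insert.prems(1) obtain c where
      c: "\<exists>i\<in>?I. c i \<noteq> 0" "\<And>j. j \<in> J \<Longrightarrow> (\<Sum>i\<in>?I. c i * v' i j) = 0" by auto
    define c' where "c' = c(k := - (\<Sum>i\<in>?I. c i * v i e) / v k e)"
    have eq: "(\<Sum>i\<in>I. c' i * v i j) = (\<Sum>i\<in>?I. c i * v' i j)" for j
    proof -
      have "(\<Sum>i\<in>I. c' i * v i j) = c' k * v k j + (\<Sum>i\<in>?I. c' i * v i j)"
        using insert.prems(1) k(1) by (rule sum.remove)
      also have "(\<Sum>i\<in>?I. c' i * v i j) = (\<Sum>i\<in>?I. c i * v i j)"
        by (rule sum.cong) (auto simp: c'_def)
      also have "c' k * v k j = - (\<Sum>i\<in>?I. c i * (v i e / v k e * v k j))"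
        by (simp add: c'_def sum_distrib_left sum_distrib_right sum_divide_distrib mult_ac)
      finally show ?thesis
        by (simp add: v'_def right_diff_distrib sum_subtractf)
    qed
    have "v' i e = 0" for i using k(2) by (simp add: v'_def)
    then have "\<forall>j\<in>insert e J. (\<Sum>i\<in>I. c' i * v i j) = 0"
      using c(2) by (auto simp: eq)
    moreover have "\<exists>i\<in>I. c' i \<noteq> 0" using c(1) by (auto simp: c'_def)
    ultimately show ?thesis by blast
  qed
qed

definition bimonom :: "nat \<times> nat \<Rightarrow> (nat \<Rightarrow>\<^sub>0 nat)" where
  "bimonom e = Poly_Mapping.single 0 (fst e) + Poly_Mapping.single 1 (snd e)"

lemma lookup_bimonom:
  "Poly_Mapping.lookup (bimonom e) 0 = fst e" "Poly_Mapping.lookup (bimonom e) (Suc 0) = snd e"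
  by (simp_all add: bimonom_def lookup_add lookup_single)

lemma inj_bimonom: "inj bimonom"
  by (rule injI) (metis lookup_bimonom prod_eqI)

lemma keys_bimonom: "Poly_Mapping.keys (bimonom e) \<subseteq> {..<2}"
  by (auto simp: bimonom_def in_keys_iff lookup_add lookup_single when_def split: if_splits)

lemma eval_monom_bimonom: "eval_monom [a, b] (bimonom e) = a ^ fst e * b ^ snd e"
  by (simp add: eval_monom_def lookup_bimonom upt_rec)

lemma not_algebraically_independentI:
  fixes a b :: "'m::monoid_add \<Rightarrow>\<^sub>0 'k::field"
  assumes "a \<noteq> b" "a \<in> S" "b \<in> S" "finite I" "e \<in> I" "c e \<noteq> 0"
    and rel: "(\<Sum>e\<in>I. smult_alg (c e) (a ^ fst e * b ^ snd e)) = 0"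
  shows "\<not> algebraically_independent S"
proof
  assume ind: "algebraically_independent S"
  define p where "p = (\<Sum>e\<in>I. Poly_Mapping.single (bimonom e) (c e))"
  have lookup_p: "Poly_Mapping.lookup p (bimonom e) = c e" if "e \<in> I" for e
    using that \<open>finite I\<close>
    by (simp add: p_def lookup_sum lookup_single inj_eq[OF inj_bimonom] when_def sum.delta)
  have keys_p: "Poly_Mapping.keys p \<subseteq> bimonom ` I"
    using keys_sum[of "\<lambda>e. Poly_Mapping.single (bimonom e) (c e)" I]
    unfolding p_def by (fastforce split: if_splits)
  have "eval_poly [a, b] p =
      (\<Sum>m\<in>bimonom ` I. smult_alg (Poly_Mapping.lookup p m) (eval_monom [a, b] m))"
    unfolding eval_poly_def using \<open>finite I\<close> keys_p
    by (intro sum.mono_neutral_left)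
      (auto simp: in_keys_iff lookup_smult_alg intro!: poly_mapping_eqI)
  also have "\<dots> = (\<Sum>e\<in>I. smult_alg (c e) (a ^ fst e * b ^ snd e))"
    by (subst sum.reindex)
      (auto simp: lookup_p eval_monom_bimonom intro: inj_on_subset[OF inj_bimonom])
  finally have "eval_poly [a, b] p = 0"
    using rel by simp
  moreover have "\<forall>m\<in>Poly_Mapping.keys p. Poly_Mapping.keys m \<subseteq> {..<length [a, b]}"
  proof
    fix m
    assume "m \<in> Poly_Mapping.keys p"
    then obtain e where "m = bimonom e" using keys_p by blast
    then show "Poly_Mapping.keys m \<subseteq> {..<length [a, b]}"
      using keys_bimonom[of e] by (simp add: numeral_2_eq_2)
  qed
  ultimately have "p = 0"
    using ind assms(1-3) unfolding algebraically_independent_def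
    by (metis distinct_length_2_or_more distinct_singleton empty_set empty_subsetI insert_subset list.simps(15))
  then show False
    using lookup_p[OF \<open>e \<in> I\<close>] \<open>c e \<noteq> 0\<close> by simp
qed

text \<open>A linear map from the span of the \<open>a\<^sup>i b\<^sup>j\<close> to \<open>k\<^sup>J\<close> that is injective, although there are
  more of these monomials than elements of \<open>J\<close>, forces a linear relation between them.\<close>

lemma not_algebraically_independent_if_separated:
  fixes a b :: "'m::monoid_add \<Rightarrow>\<^sub>0 'k::field"
  assumes ab: "a \<noteq> b" "a \<in> S" "b \<in> S" and fin: "finite J" "finite I" "card J < card I"
    and sep: "\<And>c x. x = (\<Sum>e\<in>I. smult_alg (c e) (a ^ fst e * b ^ snd e)) \<Longrightarrow>
                (\<And>w. w \<in> J \<Longrightarrow> Poly_Mapping.lookup x w = 0) \<Longrightarrow> x = 0"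
  shows "\<not> algebraically_independent S"
proof -
  obtain c e where ce: "e \<in> I" "c e \<noteq> 0"
    and c: "\<forall>w\<in>J. (\<Sum>e\<in>I. c e * Poly_Mapping.lookup (a ^ fst e * b ^ snd e) w) = 0"
    using homogeneous_system_nontrivial_solution[OF fin,
        of "\<lambda>e. Poly_Mapping.lookup (a ^ fst e * b ^ snd e)"] by blast
  have "(\<Sum>e\<in>I. smult_alg (c e) (a ^ fst e * b ^ snd e)) = 0"
    by (rule sep[OF refl]) (use c in \<open>simp add: lookup_sum lookup_smult_alg\<close>)
  then show ?thesis
    using not_algebraically_independentI ab fin(2) ce by blast
qed

section \<open>Commuting elements are algebraically dependent\<close>

lemma smult_alg_mult_left: "smult_alg c x * y = smult_alg c (x * y)"
  for x y :: "'m::monoid_add \<Rightarrow>\<^sub>0 'k::field"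
  by (simp add: smult_alg_def mult_map_scale_conv_mult mult.assoc)

lemma smult_alg_mult_right: "x * smult_alg c y = smult_alg c (x * y)"
  for x y :: "'m::monoid_add \<Rightarrow>\<^sub>0 'k::field"
proof -
  have x: "x = (\<Sum>w\<in>Poly_Mapping.keys x. Poly_Mapping.single w (Poly_Mapping.lookup x w))"
    by (rule poly_mapping_eqI) (simp add: lookup_sum lookup_single when_def sum.delta in_keys_iff)
  have central: "x * Poly_Mapping.single 0 c = Poly_Mapping.single 0 c * x"
    by (subst (1 2) x) (simp add: sum_distrib_left sum_distrib_right mult_single mult.commute)
  show ?thesis
    by (simp add: smult_alg_def mult_map_scale_conv_mult central flip: mult.assoc)
qed

lemma commuting_not_algebraically_independent:
  fixes a b :: "'x word \<Rightarrow>\<^sub>0 'k::field"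
  assumes ab: "a \<noteq> b" "a \<in> S" "b \<in> S" and comm: "a * b = b * a"
  shows "\<not> algebraically_independent S"
proof (cases "degree_le 0 a")
  case True
  \<comment> \<open>Here \<open>a\<close> is a scalar, so \<open>1\<close> and \<open>a\<close> already satisfy a linear relation.\<close>
  let ?I = "{(0, 0), (1, 0)} :: (nat \<times> nat) set"
  show ?thesis
  proof (rule not_algebraically_independent_if_separated[OF ab, of "{0}" ?I])
    fix c :: "nat \<times> nat \<Rightarrow> 'k" and x
    assume x: "x = (\<Sum>e\<in>?I. smult_alg (c e) (a ^ fst e * b ^ snd e))"
      and vanish: "\<And>w. w \<in> {0} \<Longrightarrow> Poly_Mapping.lookup x w = 0"
    have "degree_le 0 (a ^ fst e * b ^ snd e)" if "e \<in> ?I" for e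
      using that True by (auto simp: degree_le_def)
    then have deg: "degree_le 0 x"
      unfolding x by (intro degree_le_sum degree_le_smult_alg)
    show "x = 0"
    proof (rule poly_mapping_eqI)
      fix w
      show "Poly_Mapping.lookup x w = Poly_Mapping.lookup 0 w"
        using degree_leD[OF deg, of w] vanish[of w]
        by (cases w) (auto simp: zero_word_def)
    qed
  qed auto
next
  case False
  have ne: "Poly_Mapping.keys a \<noteq> {}"
    using False by (auto simp: degree_le_def)
  obtain u where u: "Poly_Mapping.lookup a (Word u) \<noteq> 0" "degree_le (length u) a"
  proof -
    let ?L = "(\<lambda>w. length (letters w)) ` Poly_Mapping.keys a"
    have "Max ?L \<in> ?L"
      using ne by (intro Max_in) auto
    then obtain w where w: "w \<in> Poly_Mapping.keys a" "Max ?L = length (letters w)" by auto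
    have "degree_le (length (letters w)) a"
      unfolding degree_le_def w(2)[symmetric] by (auto intro!: Max_ge)
    then show thesis
      using that[of "letters w"] w(1) by (simp add: in_keys_iff)
  qed
  have u_ne: "u \<noteq> []"
    using False u(2) by auto
  obtain d where d: "degree_le d b"
    using degree_le_exists by blast
  define D where "D = length u + d"
  let ?I = "{..D} \<times> {..D}" and ?J = "periodic_prefix u ` {..D * D}"
  show ?thesis
  proof (rule not_algebraically_independent_if_separated[OF ab, of ?J ?I])
    have "card ?J \<le> D * D + 1"
      using card_image_le[of "{..D * D}" "periodic_prefix u"] by simp
    also have "\<dots> < card ?I"
      using u_ne by (simp add: D_def card_cartesian_product)
    finally show "card ?J < card ?I" .
  next
    fix c x
    assume x: "x = (\<Sum>e\<in>?I. smult_alg (c e) (a ^ fst e * b ^ snd e))"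
      and vanish: "\<And>w. w \<in> ?J \<Longrightarrow> Poly_Mapping.lookup x w = 0"
    have "degree_le (D * D) (a ^ fst e * b ^ snd e)" if "e \<in> ?I" for e
    proof (rule degree_le_mono)
      show "degree_le (fst e * length u + snd e * d) (a ^ fst e * b ^ snd e)"
        by (intro degree_le_mult degree_le_power u d)
      have "fst e * length u + snd e * d \<le> D * length u + D * d"
        using that by (intro add_mono mult_right_mono) auto
      then show "fst e * length u + snd e * d \<le> D * D"
        by (simp add: D_def algebra_simps)
    qed
    then have deg: "degree_le (D * D) x"
      unfolding x by (intro degree_le_sum degree_le_smult_alg)
    have "a * (a ^ i * b ^ j) = (a ^ i * b ^ j) * a" for i j
      using power_commuting_commutes[OF comm[symmetric], of j]
      by (metis mult.assoc power_commutes)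
    then have "a * x = x * a"
      by (simp add: x sum_distrib_left sum_distrib_right smult_alg_mult_left smult_alg_mult_right)
    then show "x = 0"
      using centralizer_separated[OF u(2,1) u_ne _ deg] vanish by simp
  qed auto
qed

theorem mainTheorem2:
  fixes s :: nat
  assumes "CHAR('k::field) > 0"
  shows "\<not> (\<exists>C :: (nat word \<Rightarrow>\<^sub>0 'k) set.
            C \<subseteq> free_algebra s \<and> is_subalgebra C \<and> is_commutative C \<and> trdeg C \<ge> 2)"
proof
  assume "\<exists>C :: (nat word \<Rightarrow>\<^sub>0 'k) set.
            C \<subseteq> free_algebra s \<and> is_subalgebra C \<and> is_commutative C \<and> trdeg C \<ge> 2"
  then obtain C :: "(nat word \<Rightarrow>\<^sub>0 'k) set" where C: "is_commutative C" "trdeg C \<ge> 2"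
    by blast
  have "1 < trdeg C"
    using C(2) by (rule less_le_trans[rotated]) simp
  then obtain S where S: "S \<subseteq> C" "algebraically_independent S" "1 < ecard S"
    unfolding trdeg_def less_SUP_iff by blast
  have "\<exists>a\<in>S. \<exists>b\<in>S. a \<noteq> b"
  proof (rule ccontr)
    assume "\<not> ?thesis"
    then have "finite S \<and> card S \<le> 1"
      by (metis card_le_Suc0_iff_eq finite.emptyI finite.insertI finite_subset insertI1 subsetI
          One_nat_def)
    then show False
      using S(3) by (simp add: ecard_def one_enat_def)
  qed
  then obtain a b where "a \<in> S" "b \<in> S" "a \<noteq> b" by blast
  moreover from this have "a * b = b * a"
    using C(1) S(1) unfolding is_commutative_def by blast
  ultimately show False
    using commuting_not_algebraically_independent S(2) by blast
qed

end
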